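(* For all integers $n,k,r\ge 0$ with $n\ge k$, \[ L_{r}(n,k)=\sum_{m=k}^{n}(-1)^{n-m}S_{2}(m,k\,|\,2r)\,S_{1}(n,m). \]
   Context: For a nonnegative integer $r$ and integers $0\le k\le n$, the $r$-Lah number $L_r(n,k)$ is the number of partitions of a set with $n+r$ elements into $k+r$ non-empty linearly ordered subsets such that $r$ distinguished elements lie in distinct subsets; its exponential generating function is $\sum_{n\ge k}L_r(n,k)\frac{t^n}{n!}=\frac{1}{k!}\left(\frac{1}{1-t}-1\right)^k\left(\frac{1}{1-t}\right)^{2r}$. The Stirling polynomials of the second kind are defined by $\frac1{k!}e^{xt}(e^t-1)^k=\sum_{n\ge k}S_2(n,k\,|\,x)\frac{t^n}{n!}$. The (signed) Stirling numbers of the first kind $S_1(n,m)$ are defined by $(x)_n=\sum_{m=0}^nS_1(n,m)x^m$, where $(x)_n=x(x-1)\cdots(x-n+1)$. *)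

theory Defs
  imports
    "HOL-Library.Disjoint_Sets"
    "HOL-Computational_Algebra.Computational_Algebra"
begin

text \<open>
  A linearly ordered finite set is encoded as a \<^const>\<open>distinct\<close> list of its elements.
  Injectivity of \<^const>\<open>set\<close> ensures that each block of the underlying set partition carries
  exactly one order; blocks are non-empty by \<^const>\<open>partition_on\<close>.
\<close>

definition ordered_partitions :: "'a set \<Rightarrow> nat \<Rightarrow> 'a list set set" where
  "ordered_partitions A j =
     {P. (\<forall>xs\<in>P. distinct xs) \<and> inj_on set P \<and> partition_on A (set ` P) \<and> card P = j}"

text \<open>The \<open>n + r\<close> elements are \<open>{..<n + r}\<close>, of which those in \<open>{..<r}\<close> are distinguished.\<close>

definition r_lah :: "nat \<Rightarrow> nat \<Rightarrow> nat \<Rightarrow> nat" where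
  "r_lah r n k =
     card {P \<in> ordered_partitions {..<n + r} (k + r).
             \<forall>xs\<in>P. \<forall>a<r. \<forall>b<r. a \<in> set xs \<and> b \<in> set xs \<longrightarrow> a = b}"

text \<open>
  \<open>fps_exp x\<close> is the formal series of \<open>exp (x * t)\<close>; the factor \<open>fact n\<close> extracts the
  coefficient of \<open>t ^ n / fact n\<close>.
\<close>

definition stirling_poly2 :: "nat \<Rightarrow> nat \<Rightarrow> real \<Rightarrow> real" where
  "stirling_poly2 n k x =
     fact n * fps_nth (fps_const (1 / fact k) * fps_exp x * (fps_exp 1 - 1) ^ k) n"

text \<open>
  Coefficient of \<open>x ^ m\<close> in the falling factorial \<open>x (x - 1) \<dots> (x - n + 1)\<close>; signed, unlike
  the library's \<open>stirling\<close>.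
\<close>

definition stirling1 :: "nat \<Rightarrow> nat \<Rightarrow> int" where
  "stirling1 n m = poly.coeff (\<Prod>i<n. [:- int i, 1:]) m"

end

theory Submission
  imports Defs "HOL-Combinatorics.Stirling"
begin

text \<open>
  Both sides satisfy \<open>T (n + 1, k) = T (n, k - 1) + (n + k + 2 r) T (n, k)\<close> with
  \<open>T (0, k) = [k = 0]\<close>.  On the left, the element \<open>n + r\<close> either forms a block of its own or is
  inserted into one of the \<open>(n + r) + (k + r)\<close> gaps of the \<open>k + r\<close> lists on the other \<open>n + r\<close>
  elements.  On the right, the recurrence is the combination of those of the unsigned Stirling
  numbers of the first kind and of the Stirling polynomials of the second kind.
\<close>

section \<open>Ordered partitions that separate the distinguished elements\<close>

text \<open>The ground set \<open>A\<close> and the distinguished set \<open>D\<close> are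
  arbitrary, so that the insertion of one element can be studied without index arithmetic. Bounding
  the size of \<open>set xs \<inter> D\<close> keeps the condition visibly unaffected when an
  element outside \<open>D\<close> joins a block.\<close>

definition sep_partitions :: "'a set \<Rightarrow> 'a set \<Rightarrow> nat \<Rightarrow> 'a list set set" where
  "sep_partitions A D j =
     {P \<in> ordered_partitions A j. \<forall>xs\<in>P. card (set xs \<inter> D) \<le> 1}"

lemma r_lah_eq_card_sep_partitions:
  "r_lah r n k = card (sep_partitions {..<n + r} {..<r} (k + r))"
proof -
  have "(\<forall>a<r. \<forall>b<r. a \<in> set xs \<and> b \<in> set xs \<longrightarrow> a = b)
      \<longleftrightarrow> card (set xs \<inter> {..<r}) \<le> 1" for xs
    using card_le_Suc0_iff_eq[of "set xs \<inter> {..<r}"] unfolding One_nat_def by blast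
  then show ?thesis
    unfolding r_lah_def sep_partitions_def by simp
qed

text \<open>Two non-empty lists with disjoint sets cannot have the same set, so injectivity of
  \<open>set\<close> together with disjointness of the blocks amounts to disjointness of distinct
  lists. This form refers to the lists alone and is the one that later arguments unfold.\<close>

lemma sep_partitions_iff:
  assumes "finite A"
  shows "P \<in> sep_partitions A D j \<longleftrightarrow>
    finite P \<and> (\<forall>xs\<in>P. xs \<noteq> [] \<and> distinct xs) \<and>
    (\<forall>xs\<in>P. \<forall>ys\<in>P. xs \<noteq> ys \<longrightarrow> set xs \<inter> set ys = {}) \<and>
    \<Union>(set ` P) = A \<and> card P = j \<and>
    (\<forall>xs\<in>P. card (set xs \<inter> D) \<le> 1)"
    (is "?L \<longleftrightarrow> ?R")
proof
  assume L: ?L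
  then have inj: "inj_on set P" and part: "partition_on A (set ` P)"
    by (auto simp: sep_partitions_def ordered_partitions_def)
  have "finite (set ` P)"
    using part assms by (rule finite_elements[rotated])
  then have "finite P"
    using inj by (rule finite_imageD)
  moreover have "\<forall>xs\<in>P. xs \<noteq> []"
    using part by (force simp: partition_on_def)
  moreover have "\<forall>xs\<in>P. \<forall>ys\<in>P. xs \<noteq> ys \<longrightarrow> set xs \<inter> set ys = {}"
  proof (intro ballI impI)
    fix xs ys assume "xs \<in> P" "ys \<in> P" "xs \<noteq> ys"
    moreover from this have "set xs \<noteq> set ys"
      using inj by (auto dest: inj_onD)
    ultimately show "set xs \<inter> set ys = {}"
      using part unfolding partition_on_def disjoint_def by blast
  qed
  ultimately show ?R
    using L by (simp add: sep_partitions_def ordered_partitions_def partition_on_def)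
next
  assume R: ?R
  then have ne: "\<forall>xs\<in>P. xs \<noteq> []"
    and disj: "\<forall>xs\<in>P. \<forall>ys\<in>P. xs \<noteq> ys \<longrightarrow> set xs \<inter> set ys = {}"
    by blast+
  have "inj_on set P"
  proof (intro inj_onI, rule ccontr)
    fix xs ys assume xy: "xs \<in> P" "ys \<in> P" "set xs = set ys" "xs \<noteq> ys"
    then have "set xs \<inter> set ys = {}" using disj by blast
    then have "xs = []" using xy(3) by simp
    then show False using ne xy(1) by blast
  qed
  moreover have "disjoint (set ` P)"
    unfolding disjoint_def ball_simps using disj by metis
  moreover have "{} \<notin> set ` P" using ne by auto
  ultimately show ?L
    using R unfolding sep_partitions_def ordered_partitions_def partition_on_def by blast
qed

lemma finite_sep_partitions:
  assumes "finite A"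
  shows "finite (sep_partitions A D j)"
proof (rule finite_subset)
  show "sep_partitions A D j \<subseteq> Pow {xs. set xs \<subseteq> A \<and> distinct xs}"
    using assms by (auto simp: sep_partitions_iff)
  show "finite (Pow {xs. set xs \<subseteq> A \<and> distinct xs})"
    using assms by (simp add: finite_subset_distinct)
qed

text \<open>Every block lies inside \<open>D\<close> and may contain only one element of
  \<open>D\<close>, so all blocks are singletons. This yields the initial value of the
  recurrence.\<close>

lemma sep_partitions_self:
  assumes "finite D"
  shows "sep_partitions D D j = (if j = card D then {(\<lambda>x. [x]) ` D} else {})"
proof -
  have "P \<in> sep_partitions D D j \<longleftrightarrow> P = (\<lambda>x. [x]) ` D \<and> j = card D" for P
  proof
    assume P: "P \<in> sep_partitions D D j"
    then have dist: "\<forall>xs\<in>P. xs \<noteq> [] \<and> distinct xs" and U: "\<Union>(set ` P) = D"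
      and sep: "\<forall>xs\<in>P. card (set xs \<inter> D) \<le> 1"
      unfolding sep_partitions_iff[OF assms] by blast+
    have single: "\<exists>x\<in>D. xs = [x]" if xs: "xs \<in> P" for xs
    proof -
      have sub: "set xs \<subseteq> D" using U xs by blast
      have ne: "xs \<noteq> []" and d: "distinct xs" using dist xs by blast+
      have "length xs \<le> 1"
        using sep xs sub d by (metis distinct_card inf.absorb1)
      moreover have "length xs \<noteq> 0" using ne by simp
      ultimately have "length xs = Suc 0" by linarith
      then obtain x where "xs = [x]" by (auto simp: length_Suc_conv)
      then show ?thesis using sub by auto
    qed
    have "P = (\<lambda>x. [x]) ` D"
    proof
      show "P \<subseteq> (\<lambda>x. [x]) ` D" using single by blast
      show "(\<lambda>x. [x]) ` D \<subseteq> P"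
      proof
        fix ys assume "ys \<in> (\<lambda>x. [x]) ` D"
        then obtain x where x: "x \<in> D" "ys = [x]" by blast
        obtain xs where "xs \<in> P" "x \<in> set xs" using U x by blast
        then show "ys \<in> P" using single[of xs] x by auto
      qed
    qed
    moreover have "card ((\<lambda>x. [x]) ` D) = card D"
      by (rule card_image) (simp add: inj_on_def)
    ultimately show "P = (\<lambda>x. [x]) ` D \<and> j = card D"
      using P unfolding sep_partitions_iff[OF assms] by metis
  next
    assume "P = (\<lambda>x. [x]) ` D \<and> j = card D"
    moreover have "card ((\<lambda>x. [x]) ` D) = card D"
      by (rule card_image) (simp add: inj_on_def)
    ultimately show "P \<in> sep_partitions D D j"
      unfolding sep_partitions_iff[OF assms] using assms by auto
  qed
  then show ?thesis by (intro set_eqI) simp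
qed

section \<open>Counting the gaps of a partition\<close>

lemma sum_length_sep_partition:
  assumes "finite A" "P \<in> sep_partitions A D j"
  shows "(\<Sum>xs\<in>P. length xs) = card A"
proof -
  have P: "finite P" "\<forall>xs\<in>P. distinct xs" "\<Union>(set ` P) = A"
    "\<forall>xs\<in>P. \<forall>ys\<in>P. xs \<noteq> ys \<longrightarrow> set xs \<inter> set ys = {}"
    using assms by (auto simp: sep_partitions_iff)
  have "card (\<Union>xs\<in>P. set xs) = (\<Sum>xs\<in>P. card (set xs))"
    using P by (intro card_UN_disjoint) auto
  also have "\<dots> = (\<Sum>xs\<in>P. length xs)"
    using P by (intro sum.cong) (auto simp: distinct_card)
  finally show ?thesis using P(3) by simp
qed

text \<open>A pair \<open>(ys, zs)\<close> with \<open>ys @ zs \<in> P\<close> encodes a gap in one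
  of the lists of \<open>P\<close>. The index runs up to \<open>length xs\<close> inclusive because
  both ends of a list count as gaps.\<close>

lemma bij_betw_splits:
  "bij_betw (\<lambda>(xs, i). (take i xs, drop i xs))
     (SIGMA xs:P. {..length xs}) {(ys, zs). ys @ zs \<in> P}"
  by (rule bij_betwI[where g = "\<lambda>(ys, zs). (ys @ zs, length ys)"]) auto

lemma card_splits:
  assumes "finite P"
  shows "card {(ys, zs). ys @ zs \<in> P} = (\<Sum>xs\<in>P. length xs) + card P"
proof -
  have "card {(ys, zs). ys @ zs \<in> P} = card (SIGMA xs:P. {..length xs})"
    using bij_betw_same_card[OF bij_betw_splits] by metis
  also have "\<dots> = (\<Sum>xs\<in>P. Suc (length xs))"
    using assms by simp
  also have "\<dots> = (\<Sum>xs\<in>P. length xs) + card P"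
    using sum.distrib[of length "\<lambda>_. 1" P] by simp
  finally show ?thesis .
qed

lemma finite_splits:
  assumes "finite P"
  shows "finite {(ys, zs). ys @ zs \<in> P}"
  using bij_betw_finite[OF bij_betw_splits[of P]] assms by simp

section \<open>Inserting a non-distinguished element\<close>

lemma card_sep_partitions_insert:
  assumes A: "finite A" and a: "a \<notin> A" "a \<notin> D"
  shows "card (sep_partitions (insert a A) D j) =
    (if j = 0 then 0 else card (sep_partitions A D (j - 1)))
    + (card A + j) * card (sep_partitions A D j)"
proof -
  define New where "New = (if j = 0 then {} else insert [a] ` sep_partitions A D (j - 1))"
  define I where "I = (SIGMA Q:sep_partitions A D j. {(ys, zs). ys @ zs \<in> Q})"
  define f where "f = (\<lambda>(Q, ys, zs). insert (ys @ a # zs) (Q - {ys @ zs}))"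
  note iff = sep_partitions_iff[OF A]
  have A': "finite (insert a A)" using A by simp
  note iff' = sep_partitions_iff[OF A']
  have notin: "a \<notin> set xs" if "Q \<in> sep_partitions A D i" "xs \<in> Q" for Q xs i
    using that a unfolding iff by auto
  have New_sub: "New \<subseteq> sep_partitions (insert a A) D j"
  proof
    fix P assume "P \<in> New"
    then obtain Q where Q: "j > 0" "P = insert [a] Q" "Q \<in> sep_partitions A D (j - 1)"
      by (auto simp: New_def split: if_splits)
    have "[a] \<notin> Q" using notin[OF Q(3)] by fastforce
    moreover have "\<forall>xs\<in>Q. a \<notin> set xs" using notin[OF Q(3)] by blast
    ultimately show "P \<in> sep_partitions (insert a A) D j"
      using Q(3) Q(1) a unfolding iff iff' Q(2) by auto
  qed
  have f_sub: "f ` I \<subseteq> sep_partitions (insert a A) D j"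
  proof
    fix P assume "P \<in> f ` I"
    then obtain Q ys zs where Q: "Q \<in> sep_partitions A D j" "ys @ zs \<in> Q"
      and P: "P = insert (ys @ a # zs) (Q - {ys @ zs})"
      by (auto simp: I_def f_def)
    have na: "\<forall>xs\<in>Q. a \<notin> set xs" using notin[OF Q(1)] by blast
    then have nin: "ys @ a # zs \<notin> Q" by fastforce
    have s: "set (ys @ a # zs) = insert a (set (ys @ zs))" by auto
    have fin: "finite Q" and j: "card Q = j" and U: "\<Union>(set ` Q) = A"
      and dist: "\<forall>xs\<in>Q. xs \<noteq> [] \<and> distinct xs"
      and disj: "\<forall>xs\<in>Q. \<forall>ys\<in>Q. xs \<noteq> ys \<longrightarrow> set xs \<inter> set ys = {}"
      and sep: "\<forall>xs\<in>Q. card (set xs \<inter> D) \<le> 1"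
      using Q(1) unfolding iff by blast+
    have "distinct (ys @ a # zs)"
      using dist Q(2) na by fastforce
    moreover have "\<Union>(set ` P) = insert a (\<Union>(set ` Q))"
      unfolding P using Q(2) s by blast
    \<comment> \<open>One list is removed, and the list replacing it is new because it contains
      \<open>a\<close>.\<close>
    moreover have "card P = j"
      using fin nin card_Suc_Diff1[OF fin Q(2)] j unfolding P
      by (subst card_insert_disjoint) auto
    moreover have "\<forall>xs\<in>Q - {ys @ zs}. set xs \<inter> set (ys @ a # zs) = {}"
      using disj Q(2) na unfolding s by blast
    moreover have "card (set (ys @ a # zs) \<inter> D) \<le> 1"
      using sep Q(2) a unfolding s Int_insert_left_if0[OF a(2)] by blast
    ultimately show "P \<in> sep_partitions (insert a A) D j"
      unfolding iff' U using fin dist disj sep unfolding P by (simp del: set_append) blast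
  qed
  have cover: "sep_partitions (insert a A) D j \<subseteq> New \<union> f ` I"
  proof
    fix P assume "P \<in> sep_partitions (insert a A) D j"
    then have fin: "finite P" and j: "card P = j" and U: "\<Union>(set ` P) = insert a A"
      and dist: "\<forall>xs\<in>P. xs \<noteq> [] \<and> distinct xs"
      and disj: "\<forall>xs\<in>P. \<forall>ys\<in>P. xs \<noteq> ys \<longrightarrow> set xs \<inter> set ys = {}"
      and sep: "\<forall>xs\<in>P. card (set xs \<inter> D) \<le> 1"
      unfolding iff' by blast+
    \<comment> \<open>Conversely, deleting \<open>a\<close> from the block \<open>xs\<close> that
      contains it gives the list \<open>ys @ zs\<close>; the other blocks form \<open>R\<close>. If
      nothing is left of the block, \<open>P\<close> belongs to \<open>New\<close>, otherwise to the
      image of \<open>f\<close>.\<close>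
    obtain xs where xs: "xs \<in> P" "a \<in> set xs" using U by blast
    then obtain ys zs where yz: "xs = ys @ a # zs" by (auto dest: split_list)
    have "distinct xs" using dist xs(1) by blast
    then have d: "distinct (ys @ zs)" "a \<notin> set (ys @ zs)"
      using yz by auto
    have s: "set xs = insert a (set (ys @ zs))" using yz by auto
    define R where "R = P - {xs}"
    have P: "P = insert xs R" "xs \<notin> R" using xs by (auto simp: R_def)
    have disjR: "\<forall>ws\<in>R. set ws \<inter> set xs = {}"
      using disj xs(1) unfolding R_def by blast
    have U': "\<Union>(set ` R) \<union> set (ys @ zs) = A"
    proof -
      have "insert a (\<Union>(set ` R) \<union> set (ys @ zs)) = insert a A"
        using U unfolding P(1) s[symmetric] by (simp add: s Un_commute)
      moreover have "a \<notin> \<Union>(set ` R) \<union> set (ys @ zs)"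
        using disjR d s by blast
      ultimately show ?thesis using a by (meson insert_ident)
    qed
    have cR: "j = Suc (card R)" using j fin P by (metis card_insert_disjoint finite_insert)
    show "P \<in> New \<union> f ` I"
    proof (cases "ys @ zs = []")
      case True
      then have "R \<in> sep_partitions A D (j - 1)"
        unfolding iff using fin dist disj sep U' cR unfolding P by auto
      moreover have "P = insert [a] R" using P(1) yz True by simp
      ultimately show ?thesis using cR by (simp add: New_def)
    next
      case False
      \<comment> \<open>Hence adding \<open>ys @ zs\<close> to \<open>R\<close> restores the block
        count \<open>j\<close>, and the removal inside \<open>f\<close> gives back exactly
        \<open>R\<close>.\<close>
      have nR: "ys @ zs \<notin> R"
      proof
        assume "ys @ zs \<in> R"
        then have "set (ys @ zs) \<inter> set xs = {}" using disjR by blast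
        then show False using False unfolding s by auto
      qed
      have disj': "\<forall>ws\<in>R. set ws \<inter> set (ys @ zs) = {}"
        using disjR unfolding s by blast
      have sep': "card (set (ys @ zs) \<inter> D) \<le> 1"
        using sep xs(1) s Int_insert_left_if0[OF a(2)] by metis
      have "insert (ys @ zs) R \<in> sep_partitions A D j"
        unfolding iff
      proof (intro conjI)
        show "finite (insert (ys @ zs) R)" using fin P by simp
        show "\<forall>ws\<in>insert (ys @ zs) R. ws \<noteq> [] \<and> distinct ws"
          using dist d False P(1) by blast
        show "\<forall>us\<in>insert (ys @ zs) R. \<forall>ws\<in>insert (ys @ zs) R.
            us \<noteq> ws \<longrightarrow> set us \<inter> set ws = {}"
          using disj disj' P(1) by (metis inf_commute insert_iff)
        show "\<Union>(set ` insert (ys @ zs) R) = A"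
          using U' by (simp add: Un_commute del: set_append)
        show "card (insert (ys @ zs) R) = j" using nR cR fin P by simp
        show "\<forall>ws\<in>insert (ys @ zs) R. card (set ws \<inter> D) \<le> 1"
          using sep sep' P(1) by (metis insert_iff)
      qed
      then have "(insert (ys @ zs) R, ys, zs) \<in> I" by (simp add: I_def)
      moreover have "f (insert (ys @ zs) R, ys, zs) = P"
        using nR P(1) yz by (simp add: f_def)
      ultimately show ?thesis by (metis UnI2 imageI)
    qed
  qed
  have split_nonempty: "ys @ zs \<noteq> []" if "(Q, ys, zs) \<in> I" for Q ys zs
    using that by (auto simp: I_def iff)
  \<comment> \<open>The enlarged list is the only block containing \<open>a\<close>. Both
    disjointness from \<open>New\<close> and injectivity of \<open>f\<close> rest on this.\<close>
  have recover: "xs = ys @ a # zs" if "(Q, ys, zs) \<in> I" "xs \<in> f (Q, ys, zs)" "a \<in> set xs"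
    for Q ys zs xs
    using that notin by (auto simp: I_def f_def)
  have disjoint: "New \<inter> f ` I = {}"
  proof -
    have False if "f (Q, ys, zs) \<in> New" "(Q, ys, zs) \<in> I" for Q ys zs
    proof -
      have "[a] \<in> f (Q, ys, zs)"
        using that(1) by (auto simp: New_def split: if_splits)
      then have "[a] = ys @ a # zs" using recover that(2) by simp
      then show False using split_nonempty[OF that(2)] by (simp add: Cons_eq_append_conv)
    qed
    then show ?thesis by force
  qed
  have inj: "inj_on f I"
  proof (rule inj_onI)
    fix p p' assume "p \<in> I" "p' \<in> I" "f p = f p'"
    moreover obtain Q ys zs Q' ys' zs' where p: "p = (Q, ys, zs)" "p' = (Q', ys', zs')"
      by (metis prod_cases3)
    ultimately have I: "(Q, ys, zs) \<in> I" "(Q', ys', zs') \<in> I"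
      and eq: "f (Q, ys, zs) = f (Q', ys', zs')"
      by simp_all
    have "ys @ a # zs \<in> f (Q', ys', zs')"
      unfolding eq[symmetric] by (simp add: f_def)
    then have same: "ys @ a # zs = ys' @ a # zs'" using recover[OF I(2)] by simp
    \<comment> \<open>Since \<open>a\<close> occurs only once in the common list, the parts before
      and after it are determined.\<close>
    have na: "a \<notin> set (ys @ zs)" "a \<notin> set (ys' @ zs')"
      using I notin unfolding I_def by blast+
    then have yz: "ys = ys'" "zs = zs'"
      using same by (auto simp: append_Cons_eq_iff)
    \<comment> \<open>Undoing the insertion recovers \<open>Q\<close> from its image and the
      gap.\<close>
    have "Q = insert (ys @ zs) (f (Q, ys, zs) - {ys @ a # zs})"
      if "(Q, ys, zs) \<in> I" for Q
    proof -
      have "ys @ zs \<in> Q" "ys @ a # zs \<notin> Q"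
        using that notin[of Q j "ys @ a # zs"] by (auto simp: I_def)
      then show ?thesis by (auto simp: f_def)
    qed
    then have "Q = Q'" using I eq yz by metis
    then show "p = p'" using p yz by simp
  qed
  have card_I: "card I = (card A + j) * card (sep_partitions A D j)"
  proof -
    have "card I = (\<Sum>Q\<in>sep_partitions A D j. card {(ys, zs). ys @ zs \<in> Q})"
      unfolding I_def using finite_sep_partitions[OF A]
      by (intro card_SigmaI) (auto simp: iff intro!: finite_splits)
    \<comment> \<open>The lists of \<open>Q\<close> have total length \<open>card A\<close>, and
      each of the \<open>j\<close> lists has one more gap than its length.\<close>
    also have "\<dots> = (\<Sum>Q\<in>sep_partitions A D j. card A + j)"
    proof (rule sum.cong)
      fix Q assume Q: "Q \<in> sep_partitions A D j"
      then have "finite Q" "card Q = j" by (auto simp: iff)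
      then show "card {(ys, zs). ys @ zs \<in> Q} = card A + j"
        using card_splits sum_length_sep_partition[OF A Q] by metis
    qed simp
    finally show ?thesis by simp
  qed
  have card_New: "card New = (if j = 0 then 0 else card (sep_partitions A D (j - 1)))"
  proof -
    have "inj_on (insert [a]) (sep_partitions A D (j - 1))"
    proof (rule inj_onI)
      fix P Q assume PQ: "P \<in> sep_partitions A D (j - 1)" "Q \<in> sep_partitions A D (j - 1)"
        and "insert [a] P = insert [a] Q"
      moreover have "[a] \<notin> P" "[a] \<notin> Q"
        using notin[OF PQ(1)] notin[OF PQ(2)] by fastforce+
      ultimately show "P = Q" by (meson insert_ident)
    qed
    then show ?thesis by (simp add: New_def card_image)
  qed
  have eq: "sep_partitions (insert a A) D j = New \<union> f ` I"
    using New_sub f_sub cover by blast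
  have "card (New \<union> f ` I) = card New + card (f ` I)"
    using disjoint finite_sep_partitions[OF A', of D j] unfolding eq
    by (intro card_Un_disjoint) auto
  then show ?thesis
    unfolding eq using card_image[OF inj] card_I card_New by simp
qed

section \<open>Initial values and recurrence of the r-Lah numbers\<close>

lemma r_lah_0: "r_lah r 0 k = (if k = 0 then 1 else 0)"
  by (simp add: r_lah_eq_card_sep_partitions sep_partitions_self)

text \<open>Pigeonhole principle: sending each distinguished element to a block containing it is
  injective, so at least \<open>card D\<close> blocks are required.\<close>

lemma sep_partitions_few_blocks:
  assumes "finite A" "D \<subseteq> A" "j < card D"
  shows "sep_partitions A D j = {}"
proof (rule ccontr)
  assume "sep_partitions A D j \<noteq> {}"
  then obtain P where P: "P \<in> sep_partitions A D j" by blast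
  then have fin: "finite P" and U: "\<Union>(set ` P) = A" and card: "card P = j"
    and sep: "\<forall>xs\<in>P. card (set xs \<inter> D) \<le> 1"
    unfolding sep_partitions_iff[OF assms(1)] by blast+
  have "\<forall>d\<in>D. \<exists>xs\<in>P. d \<in> set xs"
    using assms(2) U by blast
  then obtain h where h: "\<And>d. d \<in> D \<Longrightarrow> h d \<in> P \<and> d \<in> set (h d)" by metis
  have "inj_on h D"
  proof (rule inj_onI)
    fix x y assume xy: "x \<in> D" "y \<in> D" "h x = h y"
    then have "x \<in> set (h x) \<inter> D" "y \<in> set (h x) \<inter> D"
      using h[of x] h[of y] by auto
    moreover have "card (set (h x) \<inter> D) \<le> Suc 0"
      using sep h[OF xy(1)] by simp
    ultimately show "x = y"
      using card_le_Suc0_iff_eq[of "set (h x) \<inter> D"] by blast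
  qed
  moreover have "h ` D \<subseteq> P" using h by blast
  ultimately have "card D \<le> card P"
    using fin by (rule card_inj_on_le)
  then show False
    using card assms(3) by simp
qed

lemma r_lah_Suc:
  "r_lah r (Suc n) k =
     (if k = 0 then 0 else r_lah r n (k - 1)) + (n + k + 2 * r) * r_lah r n k"
proof -
  have "{..<Suc n + r} = insert (n + r) {..<n + r}" by auto
  then have "r_lah r (Suc n) k =
      (if k + r = 0 then 0 else card (sep_partitions {..<n + r} {..<r} (k + r - 1)))
      + (n + r + (k + r)) * r_lah r n k"
    unfolding r_lah_eq_card_sep_partitions
    using card_sep_partitions_insert[of "{..<n + r}" "n + r" "{..<r}" "k + r"] by simp
  \<comment> \<open>For \<open>k > 0\<close> the block count is \<open>(k - 1) + r\<close>. For
    \<open>k = 0 < r\<close> only \<open>r - 1\<close> blocks are available for \<open>r\<close>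
    distinguished elements, so the count is zero.\<close>
  also have "(if k + r = 0 then 0 else card (sep_partitions {..<n + r} {..<r} (k + r - 1)))
      = (if k = 0 then 0 else r_lah r n (k - 1))"
    using sep_partitions_few_blocks[of "{..<n + r}" "{..<r}" "r - 1"]
    by (auto simp: r_lah_eq_card_sep_partitions)
  finally show ?thesis by (simp add: algebra_simps mult_2)
qed

section \<open>Stirling polynomials of the second kind\<close>

lemma stirling_poly2_0: "stirling_poly2 0 k x = (if k = 0 then 1 else 0)"
  by (simp add: stirling_poly2_def fps_mult_nth_0 fps_power_zeroth)

text \<open>Differentiating an exponential generating function shifts its coefficients, so the
  recurrence is a differential equation for the series \<open>F k\<close>.\<close>

lemma stirling_poly2_Suc:
  "stirling_poly2 (Suc n) k x =
     (if k = 0 then 0 else stirling_poly2 n (k - 1) x) + (real k + x) * stirling_poly2 n k x"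
proof -
  define F where "F k = fps_const (1 / fact k) * fps_exp x * (fps_exp 1 - 1) ^ k" for k
  have S: "stirling_poly2 n k x = fact n * fps_nth (F k) n" for n k
    by (simp add: stirling_poly2_def F_def)
  have deriv: "fps_deriv (F k) =
      (if k = 0 then 0 else F (k - 1)) + fps_const (real k + x) * F k"
  proof (cases k)
    case 0
    then show ?thesis by (simp add: F_def)
  next
    case (Suc l)
    define E where "E = fps_exp (1::real)"
    have c: "fps_const (1 / fact (Suc l)) * fps_const (real (Suc l)) = fps_const (1 / fact l :: real)"
      by (simp add: field_simps del: of_nat_Suc)
    \<comment> \<open>The derivative of \<open>E - 1\<close> is \<open>E\<close>, written as
      \<open>(E - 1) + 1\<close>: the first summand restores the power \<open>k\<close> with factor
      \<open>k\<close>, and the second leaves the power \<open>k - 1\<close>, which gives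
      \<open>F (k - 1)\<close>.\<close>
    have "fps_deriv (F k) = fps_const (1 / fact (Suc l)) *
        (fps_const x * fps_exp x * (E - 1) ^ Suc l
          + fps_exp x * (fps_const (real (Suc l)) * ((E - 1) + 1) * (E - 1) ^ l))"
      by (simp add: F_def Suc E_def fps_deriv_power algebra_simps
          del: power_Suc fps_const_mult fact_Suc of_nat_Suc)
    also have "\<dots> = fps_const x * F k + fps_const (real k) * F k
        + (fps_const (1 / fact (Suc l)) * fps_const (real (Suc l))) * fps_exp x * (E - 1) ^ l"
      by (simp add: F_def Suc E_def[symmetric] algebra_simps
          del: fps_const_mult fact_Suc of_nat_Suc)
    also have "\<dots> = F l + fps_const (real k + x) * F k"
      unfolding c
      by (simp add: F_def E_def algebra_simps flip: fps_const_add)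
    finally show ?thesis by (simp add: Suc)
  qed
  have "stirling_poly2 (Suc n) k x = fact n * fps_nth (fps_deriv (F k)) n"
    by (simp add: S algebra_simps)
  then show ?thesis
    by (simp add: deriv S algebra_simps)
qed

lemma stirling_poly2_eq_0: "n < k \<Longrightarrow> stirling_poly2 n k x = 0"
  by (induction n arbitrary: k) (auto simp: stirling_poly2_0 stirling_poly2_Suc)

section \<open>Signed Stirling numbers of the first kind\<close>

lemma stirling1_0: "stirling1 0 m = (if m = 0 then 1 else 0)"
  by (simp add: stirling1_def)

lemma stirling1_Suc:
  "stirling1 (Suc n) m = (if m = 0 then 0 else stirling1 n (m - 1)) - int n * stirling1 n m"
  by (cases m) (simp_all add: stirling1_def mult.commute[of _ "[:- int n, 1:]"])

text \<open>The factor \<open>(-1) ^ (n + m)\<close> equals \<open>(-1) ^ (n - m)\<close> for \<open>m \<le> n\<close> but avoids truncated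
  subtraction.\<close>

lemma stirling1_eq_stirling: "stirling1 n m = (-1) ^ (n + m) * int (stirling n m)"
proof (induction n arbitrary: m)
  case 0
  then show ?case by (cases m) (simp_all add: stirling1_0)
next
  case (Suc n)
  show ?case
  proof (cases m)
    case 0
    \<comment> \<open>Either alternative makes the remaining term
      \<open>int n * stirling1 n 0\<close> vanish.\<close>
    have "n = 0 \<or> stirling n 0 = 0" by (cases n) simp_all
    then show ?thesis using 0 by (auto simp: stirling1_Suc Suc.IH)
  next
    case (Suc l)
    then show ?thesis by (simp add: stirling1_Suc Suc.IH algebra_simps)
  qed
qed

section \<open>The sum formula\<close>

text \<open>Induction on \<open>n\<close> by matching recurrences; \<open>k\<close> is arbitrary
  because the recurrence also reaches \<open>k - 1\<close>. Unsigned Stirling numbers and a sum from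
  0 keep signs and the lower limit \<open>k\<close> out of the induction.\<close>

lemma r_lah_eq_sum_stirling:
  "real (r_lah r n k) = (\<Sum>m\<le>n. real (stirling n m) * stirling_poly2 m k (2 * real r))"
proof (induction n arbitrary: k)
  case 0
  then show ?case by (simp add: r_lah_0 stirling_poly2_0)
next
  case (Suc n)
  let ?S = "\<lambda>m k. stirling_poly2 m k (2 * real r)"
  \<comment> \<open>The term \<open>m = 0\<close> vanishes, and the shifted index fits the
    recurrence of \<open>stirling\<close>.\<close>
  have "(\<Sum>m\<le>Suc n. real (stirling (Suc n) m) * ?S m k)
      = (\<Sum>m\<le>n. real (stirling (Suc n) (Suc m)) * ?S (Suc m) k)"
    by (subst sum.atMost_Suc_shift) simp
  also have "\<dots> = real n * (\<Sum>m\<le>n. real (stirling n (Suc m)) * ?S (Suc m) k)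
      + (\<Sum>m\<le>n. real (stirling n m) * ?S (Suc m) k)"
    by (simp add: algebra_simps sum.distrib sum_distrib_left)
  \<comment> \<open>Shifting back adds the term \<open>m = 0\<close>, which is zero for
    \<open>n > 0\<close>, and the top term is zero because \<open>stirling n (Suc n) = 0\<close>.
    For \<open>n = 0\<close> the factor \<open>real n\<close> makes both sides zero.\<close>
  also have "real n * (\<Sum>m\<le>n. real (stirling n (Suc m)) * ?S (Suc m) k)
      = real n * (\<Sum>m\<le>n. real (stirling n m) * ?S m k)"
  proof (cases n)
    case (Suc l)
    have "(\<Sum>m\<le>n. real (stirling n (Suc m)) * ?S (Suc m) k)
        = (\<Sum>m\<le>Suc n. real (stirling n m) * ?S m k)"
      by (subst sum.atMost_Suc_shift) (simp add: Suc)
    then show ?thesis by simp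
  qed simp
  also have "(\<Sum>m\<le>n. real (stirling n m) * ?S (Suc m) k)
      = (if k = 0 then 0 else \<Sum>m\<le>n. real (stirling n m) * ?S m (k - 1))
        + (real k + 2 * real r) * (\<Sum>m\<le>n. real (stirling n m) * ?S m k)"
    by (simp add: stirling_poly2_Suc algebra_simps sum.distrib sum_distrib_left)
  finally have "(\<Sum>m\<le>Suc n. real (stirling (Suc n) m) * ?S m k)
      = real n * real (r_lah r n k) + ((if k = 0 then 0 else real (r_lah r n (k - 1)))
        + (real k + 2 * real r) * real (r_lah r n k))"
    unfolding Suc.IH .
  then show ?case
    by (simp only: r_lah_Suc) (simp add: algebra_simps)
qed

theorem theorem8:
  fixes n k r :: nat
  assumes "k \<le> n"
  shows "real (r_lah r n k) =
    (\<Sum>m=k..n. (-1) ^ (n - m) * stirling_poly2 m k (2 * real r) * real_of_int (stirling1 n m))"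
proof -
  \<comment> \<open>The exponents add up to \<open>2 * n\<close>.\<close>
  have sgn: "(-1 :: real) ^ (n - m) * (-1) ^ (n + m) = 1" if "m \<le> n" for m
    using that by (simp flip: power_add)
  have "real (r_lah r n k) = (\<Sum>m\<le>n. real (stirling n m) * stirling_poly2 m k (2 * real r))"
    by (rule r_lah_eq_sum_stirling)
  \<comment> \<open>The terms with \<open>m < k\<close> drop out because \<open>(e^t - 1)^k\<close>
    has no powers of \<open>t\<close> below \<open>k\<close>.\<close>
  also have "\<dots> = (\<Sum>m=k..n. real (stirling n m) * stirling_poly2 m k (2 * real r))"
    by (rule sum.mono_neutral_right) (auto simp: stirling_poly2_eq_0)
  also have "\<dots> = (\<Sum>m=k..n. (-1) ^ (n - m) * stirling_poly2 m k (2 * real r)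
      * real_of_int (stirling1 n m))"
  proof (rule sum.cong)
    fix m assume "m \<in> {k..n}"
    then have "((-1 :: real) ^ (n - m) * (-1) ^ (n + m))
        * (real (stirling n m) * stirling_poly2 m k (2 * real r))
        = real (stirling n m) * stirling_poly2 m k (2 * real r)"
      using sgn[of m] by simp
    then show "real (stirling n m) * stirling_poly2 m k (2 * real r)
        = (-1) ^ (n - m) * stirling_poly2 m k (2 * real r) * real_of_int (stirling1 n m)"
      by (simp add: stirling1_eq_stirling mult_ac)
  qed simp
  finally show ?thesis .
qed

end
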